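(* Let $S$ be a finite semigroup. The following are equivalent: (i) $S$ is completely regular; (ii) $\mathbb{Z}\times S$ contains only countably many subsemigroups; (iii) $\mathbb{Z}\times S$ contains only countably many subsemigroups up to isomorphism.
   Context: $\mathbb{Z}$ denotes the additive (semi)group of integers, and $\mathbb{Z}\times S$ is the direct product semigroup. A semigroup $S$ is completely regular (a union of groups) if every element of $S$ belongs to a subgroup of $S$, i.e. to a subsemigroup of $S$ that is a group under the restricted operation. "Only countably many" means the number is finite or countably infinite; "up to isomorphism" means counting isomorphism classes of the subsemigroups regarded as abstract semigroups. *)

theory Defs
  imports "HOL-Algebra.Elementary_Groups" "HOL-Library.Countable_Set"
begin

text \<open>
  Semigroups are carried by the record type \<open>monoid\<close> of HOL-Algebra, so that its
  direct product, its isomorphism relation and its groups are available. The field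
  \<open>one\<close> of such a record is ignored throughout: nothing is assumed about it, and \<open>hom\<close>,
  \<open>iso\<close> and hence \<open>\<cong>\<close> refer only to carrier and multiplication.
\<close>

locale carrier_semigroup =
  fixes S (structure)
  assumes carrier_nonempty: "carrier S \<noteq> {}"
    and m_closed: "\<lbrakk>x \<in> carrier S; y \<in> carrier S\<rbrakk> \<Longrightarrow> x \<otimes> y \<in> carrier S"
    and m_assoc: "\<lbrakk>x \<in> carrier S; y \<in> carrier S; z \<in> carrier S\<rbrakk>
      \<Longrightarrow> (x \<otimes> y) \<otimes> z = x \<otimes> (y \<otimes> z)"

definition subsemigroups :: "('a, 'm) monoid_scheme \<Rightarrow> 'a set set" where
  "subsemigroups S = {T. T \<subseteq> carrier S \<and> T \<noteq> {} \<and> (\<forall>x\<in>T. \<forall>y\<in>T. x \<otimes>\<^bsub>S\<^esub> y \<in> T)}"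

text \<open>
  The identity \<open>e\<close> of a subgroup of a semigroup varies with the subgroup; hence it is
  existentially quantified, and the HOL-Algebra predicate \<open>subgroup\<close>, which demands
  the ambient \<open>one\<close>, is not used.
\<close>

definition is_subgroup_of_semigroup :: "'a set \<Rightarrow> ('a, 'm) monoid_scheme \<Rightarrow> bool" where
  "is_subgroup_of_semigroup H S \<longleftrightarrow>
     H \<in> subsemigroups S \<and> (\<exists>e. group (S\<lparr>carrier := H, one := e\<rparr>))"

definition completely_regular :: "('a, 'm) monoid_scheme \<Rightarrow> bool" where
  "completely_regular S \<longleftrightarrow> (\<forall>x\<in>carrier S. \<exists>H. is_subgroup_of_semigroup H S \<and> x \<in> H)"

definition subsemigroup_iso_rel :: "('a, 'm) monoid_scheme \<Rightarrow> ('a set \<times> 'a set) set" where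
  "subsemigroup_iso_rel S =
     {(T, U). T \<in> subsemigroups S \<and> U \<in> subsemigroups S \<and> S\<lparr>carrier := T\<rparr> \<cong> S\<lparr>carrier := U\<rparr>}"

lemma equiv_subsemigroup_iso_rel: "equiv (subsemigroups S) (subsemigroup_iso_rel S)"
proof (rule equivI)
  show "subsemigroup_iso_rel S \<subseteq> subsemigroups S \<times> subsemigroups S"
    by (auto simp: subsemigroup_iso_rel_def)
  show "refl_on (subsemigroups S) (subsemigroup_iso_rel S)"
    by (auto simp: refl_on_def subsemigroup_iso_rel_def)
  show "trans (subsemigroup_iso_rel S)"
    by (auto simp: trans_def subsemigroup_iso_rel_def intro: iso_trans)
  show "sym (subsemigroup_iso_rel S)"
  proof (rule symI)
    fix T U assume TU: "(T, U) \<in> subsemigroup_iso_rel S"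
    then obtain h where T: "T \<in> subsemigroups S" and U: "U \<in> subsemigroups S"
      and hom: "\<And>x y. x \<in> T \<Longrightarrow> y \<in> T \<Longrightarrow> h (x \<otimes>\<^bsub>S\<^esub> y) = h x \<otimes>\<^bsub>S\<^esub> h y"
      and bij: "bij_betw h T U"
      by (auto simp: subsemigroup_iso_rel_def is_iso_def iso_def hom_def)
    let ?g = "inv_into T h"
    have gT: "?g y \<in> T" and hg: "h (?g y) = y" if "y \<in> U" for y
      using bij that by (auto simp: bij_betw_def inv_into_into f_inv_into_f)
    have "?g (x \<otimes>\<^bsub>S\<^esub> y) = ?g x \<otimes>\<^bsub>S\<^esub> ?g y" if "x \<in> U" "y \<in> U" for x y
    proof -
      have mem: "?g x \<otimes>\<^bsub>S\<^esub> ?g y \<in> T"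
        using T gT that by (auto simp: subsemigroups_def)
      have "h (?g x \<otimes>\<^bsub>S\<^esub> ?g y) = x \<otimes>\<^bsub>S\<^esub> y"
        using hom gT hg that by simp
      then show ?thesis
        using inv_into_f_f[OF _ mem] bij by (metis bij_betw_def)
    qed
    then have "?g \<in> iso (S\<lparr>carrier := U\<rparr>) (S\<lparr>carrier := T\<rparr>)"
      using gT bij_betw_inv_into[OF bij] by (auto simp: iso_def hom_def)
    then show "(U, T) \<in> subsemigroup_iso_rel S"
      using T U by (auto simp: subsemigroup_iso_rel_def is_iso_def)
  qed
qed

end

theory Submission
  imports Defs "HOL-Analysis.Finite_Cartesian_Product"
begin

text \<open>
  If \<open>S\<close> is completely regular, then every \<open>s\<close> satisfies \<open>s\<^sup>k\<^sup>+\<^sup>1 = s\<close> for some \<open>k \<ge> 1\<close>. Hence, for a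
  subsemigroup \<open>T\<close> of \<open>\<int> \<times> S\<close>, the slice \<open>T\<^sub>s = {n. (n, s) \<in> T}\<close> is closed under adding \<open>k n\<close> for each
  of its elements \<open>n\<close>, and there are only countably many sets of integers that are closed under
  adding a fixed nonzero integer.

  Otherwise some \<open>s\<close> differs from all its higher powers, and every set \<open>M\<close> of integers yields the
  subsemigroup \<open>T\<^sub>M = M \<times> {s} \<union> \<int> \<times> {s\<^sup>j | j \<ge> 2}\<close>. Some power of \<open>s\<close> is idempotent, so each
  homomorphism \<open>T\<^sub>M \<rightarrow> \<int>\<close> has the form \<open>(n, x) \<mapsto> c n\<close>, and \<open>c = \<plusminus>1\<close> if it is onto. An isomorphism
  \<open>T\<^sub>M \<rightarrow> T\<^sub>N\<close> thus maps the fibre over \<open>n\<close> onto the fibre over \<open>\<plusminus>n\<close>, and as \<open>n \<in> M\<close> can be read off from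
  the finite size of the fibre, \<open>N = \<plusminus>M\<close>.
\<close>

subsection \<open>Powers in a semigroup\<close>

text \<open>Exponents are shifted by one, because a semigroup need not have an identity: \<open>spow G x n\<close> is
  \<open>x\<^sup>n\<^sup>+\<^sup>1\<close>.\<close>

primrec spow :: "('a, 'm) monoid_scheme \<Rightarrow> 'a \<Rightarrow> nat \<Rightarrow> 'a" where
  "spow G x 0 = x"
| "spow G x (Suc n) = spow G x n \<otimes>\<^bsub>G\<^esub> x"

context carrier_semigroup
begin

lemma spow_closed: "x \<in> carrier S \<Longrightarrow> spow S x n \<in> carrier S"
  by (induction n) (auto intro: m_closed)

lemma spow_mult: "x \<in> carrier S \<Longrightarrow> spow S x m \<otimes> spow S x n = spow S x (Suc (m + n))"
proof (induction n)
  case (Suc n)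
  have "spow S x m \<otimes> spow S x (Suc n) = (spow S x m \<otimes> spow S x n) \<otimes> x"
    using Suc.prems by (simp add: m_assoc spow_closed)
  also have "\<dots> = spow S x (Suc (m + n)) \<otimes> x"
    using Suc by simp
  finally show ?case by simp
qed simp

lemma spow_spow: "x \<in> carrier S \<Longrightarrow> spow S (spow S x m) n = spow S x (m + n + m * n)"
proof (induction n)
  case (Suc n)
  then have "spow S (spow S x m) (Suc n) = spow S x (m + n + m * n) \<otimes> spow S x m"
    by simp
  also have "\<dots> = spow S x (m + Suc n + m * Suc n)"
    using Suc.prems by (simp add: spow_mult algebra_simps)
  finally show ?case .
qed simp

lemma spow_spow_commute:
  "x \<in> carrier S \<Longrightarrow> spow S (spow S x m) n = spow S (spow S x n) m"
  by (simp add: spow_spow algebra_simps)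

lemma spow_idem: "e \<otimes> e = e \<Longrightarrow> spow S e n = e"
  by (induction n) auto

section \<open>Periodicity of powers in a finite semigroup\<close>

lemma spow_repeat:
  assumes "finite (carrier S)" and "x \<in> carrier S"
  obtains i j where "i < j" "spow S x i = spow S x j"
proof -
  have "finite (range (spow S x))"
    using assms spow_closed by (meson finite_subset image_subsetI)
  then have "\<not> inj (spow S x)"
    using finite_imageD by blast
  then obtain i j where "i \<noteq> j" "spow S x i = spow S x j"
    by (auto simp: inj_def)
  then show thesis
    using that[of i j] that[of j i] by (cases i j rule: linorder_cases) auto
qed

text \<open>A repetition makes the powers periodic from index \<open>i\<close> on; a sufficiently
  large exponent that is a multiple of the period can then be doubled without changing the
  power.\<close>

lemma ex_idempotent_spow:
  assumes "finite (carrier S)" and x: "x \<in> carrier S"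
  obtains k where "spow S x k \<otimes> spow S x k = spow S x k"
proof -
  obtain i j where ij: "i < j" "spow S x i = spow S x j"
    using spow_repeat assms by blast
  define p where "p = j - i"
  have p: "p > 0" and eq: "spow S x i = spow S x (i + p)"
    using ij by (auto simp: p_def)
  have step: "spow S x (i + d) = spow S x (i + p + d)" for d
    using eq by (induction d) auto
  have period: "spow S x (i + d + q * p) = spow S x (i + d)" for d q
  proof (induction q)
    case (Suc q)
    show ?case using step[of "d + q * p"] Suc by (simp add: algebra_simps)
  qed simp
  \<comment> \<open>The true exponent \<open>Suc k\<close> is a multiple of \<open>p\<close>, so
    squaring advances by exactly \<open>Suc i\<close> periods; \<open>p > 0\<close> puts
    \<open>k\<close> in the periodic range.\<close>
  define k where "k = Suc i * p - 1"
  have k: "Suc k = Suc i * p" "i \<le> k"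
    using p mult_le_mono[of 1 p "Suc i" "Suc i"] by (auto simp: k_def algebra_simps)
  have "spow S x k \<otimes> spow S x k = spow S x (k + Suc k)"
    using spow_mult[OF x] by simp
  also have "\<dots> = spow S x k"
    using period[of "k - i" "Suc i"] k by simp
  finally show thesis using that by blast
qed

section \<open>Complete regularity as a condition on powers\<close>

lemma is_subgroup_range_spow:
  assumes x: "x \<in> carrier S" and eq: "spow S x (Suc j) = x"
  shows "is_subgroup_of_semigroup (range (spow S x)) S"
proof -
  \<comment> \<open>As \<open>x\<close> times \<open>e\<close> is \<open>x\<close> and powers of
    \<open>x\<close> commute, \<open>e\<close> is the identity of the cyclic subsemigroup generated
    by \<open>x\<close>.\<close>
  define e where "e = spow S x j"
  have e_left: "e \<otimes> spow S x n = spow S x n" for n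
    unfolding e_def
  proof (induction n)
    case (Suc n)
    have "spow S x j \<otimes> spow S x (Suc n) = (spow S x j \<otimes> spow S x n) \<otimes> x"
      using x by (simp add: m_assoc spow_closed)
    then show ?case using Suc by simp
  qed (use eq in simp)
  have e_idem: "e \<otimes> e = e"
    using e_left unfolding e_def .
  \<comment> \<open>For \<open>y = spow S x n\<close>, the power \<open>spow S y j\<close> equals
    \<open>spow S e n = e\<close>, so its square is \<open>e\<close> too. Splitting one factor
    \<open>y\<close> off the square leaves an inverse of \<open>y\<close>, with a positive exponent
    even if \<open>j = 0\<close>.\<close>
  have inverse: "spow S (spow S x n) (2 * j) \<otimes> spow S x n = e" for n
  proof -
    have "spow S (spow S x n) (2 * j) \<otimes> spow S x n = spow S (spow S x n) (Suc (2 * j))"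
      by simp
    also have "\<dots> = spow S (spow S (spow S x n) j) 1"
      using x by (subst spow_spow[of "spow S x n"]) (auto simp: spow_closed mult_2 simp flip: mult_2)
    also have "\<dots> = spow S (spow S e n) 1"
      using spow_spow_commute[OF x] by (simp add: e_def)
    also have "\<dots> = e"
      using e_idem by (simp add: spow_idem)
    finally show ?thesis .
  qed
  have "group (S\<lparr>carrier := range (spow S x), one := e\<rparr>)"
  proof (rule groupI, goal_cases)
    case (5 y)
    then obtain n where "y = spow S x n" by auto
    with inverse[of n] show ?case
      using x by (auto simp: spow_spow)
  qed (use x e_left in \<open>auto simp: spow_mult e_def add.assoc simp del: spow.simps\<close>)
  moreover have "range (spow S x) \<in> subsemigroups S"
    using x by (auto simp: subsemigroups_def spow_closed spow_mult simp del: spow.simps)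
  ultimately show ?thesis
    by (auto simp: is_subgroup_of_semigroup_def)
qed

text \<open>Finiteness makes two powers of \<open>x\<close> equal. Cancelling the smaller one inside
  the group \<open>H\<close> shows that some power of \<open>x\<close> is the identity of
  \<open>H\<close>.\<close>

lemma subgroup_imp_spow_eq_self:
  assumes fin: "finite (carrier S)" and H: "is_subgroup_of_semigroup H S" and x: "x \<in> H"
  obtains j where "x \<otimes> spow S x j = x"
proof -
  obtain e where sub: "H \<in> subsemigroups S" and grp: "group (S\<lparr>carrier := H, one := e\<rparr>)"
    using H by (auto simp: is_subgroup_of_semigroup_def)
  interpret H: group "S\<lparr>carrier := H, one := e\<rparr>" by (fact grp)
  have xS: "x \<in> carrier S" using sub x by (auto simp: subsemigroups_def)
  have pow_H: "spow S x n \<in> H" for n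
    using sub x by (induction n) (auto simp: subsemigroups_def)
  obtain i j where ij: "i < j" "spow S x i = spow S x j"
    using spow_repeat[OF fin xS] by blast
  then obtain d where d: "j = Suc (i + d)"
    using less_imp_Suc_add by blast
  have "spow S x i \<otimes> e = spow S x j"
    using H.r_one[of "spow S x i"] pow_H ij(2) by simp
  also have "\<dots> = spow S x i \<otimes> spow S x d"
    using spow_mult[OF xS] d by simp
  finally have "spow S x i \<otimes> e = spow S x i \<otimes> spow S x d" .
  then have "spow S x d = e"
    using H.Units_l_cancel[of "spow S x i" e "spow S x d"] pow_H H.one_closed H.Units_eq by simp
  then have "x \<otimes> spow S x d = x"
    using H.r_one[of x] x by simp
  then show thesis by (rule that)
qed

lemma completely_regular_iff:
  assumes "finite (carrier S)"
  shows "completely_regular S \<longleftrightarrow> (\<forall>x\<in>carrier S. \<exists>j. spow S x (Suc j) = x)"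
proof
  assume cr: "completely_regular S"
  show "\<forall>x\<in>carrier S. \<exists>j. spow S x (Suc j) = x"
  proof
    fix x assume x: "x \<in> carrier S"
    then obtain j where "x \<otimes> spow S x j = x"
      using cr subgroup_imp_spow_eq_self[OF assms] by (metis completely_regular_def)
    then have "spow S x (Suc j) = x"
      using spow_mult[OF x, of 0 j] by simp
    then show "\<exists>j. spow S x (Suc j) = x" ..
  qed
next
  assume "\<forall>x\<in>carrier S. \<exists>j. spow S x (Suc j) = x"
  then have "\<exists>H. is_subgroup_of_semigroup H S \<and> x \<in> H" if "x \<in> carrier S" for x
    using is_subgroup_range_spow[OF that] that by (metis rangeI spow.simps(1))
  then show "completely_regular S"
    by (simp add: completely_regular_def)
qed

end

lemma spow_integer_prod:
  "spow (integer_group \<times>\<times> S) (n, x) i = (int (Suc i) * n, spow S x i)"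
  by (induction i) (auto simp: algebra_simps)

lemma spow_subsemigroup:
  "T \<in> subsemigroups S \<Longrightarrow> x \<in> T \<Longrightarrow> spow S x n \<in> T"
  by (induction n) (auto simp: subsemigroups_def)

subsection \<open>Completely regular semigroups\<close>

text \<open>Such a set is empty, all of the integers (if unbounded below), or the ray from its least
  element.\<close>

lemma countable_upclosed_int: "countable {A :: int set. \<forall>x\<in>A. x + 1 \<in> A}"
proof -
  have "A \<in> insert {} (insert UNIV (range atLeast))" if A: "\<forall>x\<in>A. x + 1 \<in> A" for A :: "int set"
  proof -
    have up: "y \<in> A" if "x \<in> A" "x \<le> y" for x y
      using that(2) by (induction y rule: int_ge_induct) (use that(1) A in auto)
    show ?thesis
    proof (cases "bdd_below A \<and> A \<noteq> {}")
      case True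
      then obtain b x where b: "\<And>y. y \<in> A \<Longrightarrow> b \<le> y" and x: "x \<in> A"
        by (auto simp: bdd_below_def)
      \<comment> \<open>The minimum of \<open>A\<close> is found as the least natural offset from
        the lower bound \<open>b\<close>.\<close>
      define k where "k = (LEAST k. b + int k \<in> A)"
      have "b + int (nat (x - b)) \<in> A"
        using b[OF x] x by simp
      then have k: "b + int k \<in> A"
        unfolding k_def by (rule LeastI)
      have "b + int k \<le> y" if "y \<in> A" for y
      proof -
        have "k \<le> nat (y - b)"
          unfolding k_def using b[OF that] that by (intro Least_le) simp
        then show ?thesis
          using b[OF that] by simp
      qed
      then have "A = {b + int k..}"
        using up[OF k] by auto
      then show ?thesis by blast
    next
      case False
      have "A = UNIV" if "A \<noteq> {}"
      proof -
        have "y \<in> A" for y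
          using False that up unfolding bdd_below_def by (meson linear)
        then show ?thesis by blast
      qed
      then show ?thesis by blast
    qed
  qed
  then have "{A :: int set. \<forall>x\<in>A. x + 1 \<in> A} \<subseteq> insert {} (insert UNIV (range atLeast))"
    by blast
  then show ?thesis
    by (rule countable_subset) auto
qed

text \<open>Within each residue class modulo \<open>d\<close>, adding \<open>d\<close> raises the
  quotient by 1. So \<open>A\<close> is encoded by finitely many sets from the countable family of
  the previous lemma.\<close>

lemma countable_closed_under_add_pos:
  fixes d :: int
  assumes d: "d > 0"
  shows "countable {A. \<forall>x\<in>A. x + d \<in> A}"
proof -
  define slices where "slices A = (\<lambda>r\<in>{0..<d}. {q. r + q * d \<in> A})" for A
  have "inj slices"
  proof (rule injI)
    fix A B assume eq: "slices A = slices B"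
    have "x \<in> A \<longleftrightarrow> x \<in> B" for x
    proof -
      have "{q. x mod d + q * d \<in> A} = {q. x mod d + q * d \<in> B}"
        using fun_cong[OF eq, of "x mod d"] d by (simp add: slices_def)
      then have "x mod d + (x div d) * d \<in> A \<longleftrightarrow> x mod d + (x div d) * d \<in> B"
        by blast
      then show ?thesis by simp
    qed
    then show "A = B" by blast
  qed
  then have "inj_on slices {A. \<forall>x\<in>A. x + d \<in> A}"
    by (rule inj_on_subset) simp
  moreover have "slices ` {A. \<forall>x\<in>A. x + d \<in> A} \<subseteq> (\<Pi>\<^sub>E r\<in>{0..<d}. {A. \<forall>x\<in>A. x + 1 \<in> A})"
  proof (rule image_subsetI)
    fix A assume A: "A \<in> {A. \<forall>x\<in>A. x + d \<in> A}"
    have "r + (q + 1) * d \<in> A" if "r + q * d \<in> A" for q r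
    proof -
      have "r + q * d + d \<in> A" using A that by blast
      then show ?thesis by (simp add: algebra_simps)
    qed
    then show "slices A \<in> (\<Pi>\<^sub>E r\<in>{0..<d}. {A. \<forall>x\<in>A. x + 1 \<in> A})"
      unfolding slices_def by (intro restrict_PiE_iff[THEN iffD2]) blast
  qed
  moreover have "countable (\<Pi>\<^sub>E r\<in>{0..<d}. {A :: int set. \<forall>x\<in>A. x + 1 \<in> A})"
    using countable_upclosed_int by (intro countable_PiE) auto
  ultimately show ?thesis
    by (meson countable_subset countable_image_inj_on)
qed

lemma countable_closed_under_add:
  fixes d :: int
  assumes "d \<noteq> 0"
  shows "countable {A. \<forall>x\<in>A. x + d \<in> A}"
proof (cases "d > 0")
  case True
  then show ?thesis by (rule countable_closed_under_add_pos)
next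
  case False
  then have "countable {A. \<forall>x\<in>A. x + (- d) \<in> A}"
    using assms by (intro countable_closed_under_add_pos) simp
  \<comment> \<open>Reflection at 0 reverses the sign of the shift.\<close>
  moreover have "{A. \<forall>x\<in>A. x + d \<in> A} \<subseteq> image uminus ` {A. \<forall>x\<in>A. x + (- d) \<in> A}"
  proof
    fix A assume "A \<in> {A. \<forall>x\<in>A. x + d \<in> A}"
    then have "- (x + d) \<in> uminus ` A" if "x \<in> A" for x
      using that by blast
    then have "uminus ` A \<in> {A. \<forall>x\<in>A. x + (- d) \<in> A}"
      by auto
    moreover have "A = uminus ` uminus ` A"
      by (simp add: image_image)
    ultimately show "A \<in> image uminus ` {A. \<forall>x\<in>A. x + (- d) \<in> A}"
      by blast
  qed
  ultimately show ?thesis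
    using countable_subset by blast
qed

section \<open>Slices of subsemigroups of the product\<close>

lemma (in carrier_semigroup) countable_subsemigroups_integer_prod:
  assumes fin: "finite (carrier S)" and "completely_regular S"
  shows "countable (subsemigroups (integer_group \<times>\<times> S))"
proof -
  \<comment> \<open>\<open>\<C>\<close> contains every possible slice. Those inside
    \<open>{0}\<close> are listed separately, since the element 0 only yields the trivial
    shift.\<close>
  define \<C> where "\<C> = Pow {0} \<union> (\<Union>d\<in>-{0}. {A :: int set. \<forall>x\<in>A. x + d \<in> A})"
  define slices where "slices T = (\<lambda>s\<in>carrier S. {n. (n, s) \<in> T})" for T :: "(int \<times> 'a) set"
  have "countable \<C>"
    unfolding \<C>_def by (auto intro: countable_finite countable_closed_under_add)
  have "{n. (n, s) \<in> T} \<in> \<C>"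
    if T: "T \<in> subsemigroups (integer_group \<times>\<times> S)" and s: "s \<in> carrier S" for T s
  proof (cases "{n. (n, s) \<in> T} \<subseteq> {0}")
    case True
    then show ?thesis by (simp add: \<C>_def)
  next
    case False
    then obtain n where n: "(n, s) \<in> T" "n \<noteq> 0" by blast
    obtain j where "spow S s (Suc j) = s"
      using assms s completely_regular_iff by blast
    then have j: "s \<otimes> spow S s j = s"
      using spow_mult[OF s, of 0 j] by simp
    \<comment> \<open>The power \<open>spow S s j\<close> fixes \<open>s\<close> from the right, so
      multiplying by the matching power of \<open>(n, s)\<close> stays over \<open>s\<close> and
      only shifts the integer.\<close>
    have "(m + int (Suc j) * n, s) \<in> T" if "(m, s) \<in> T" for m
    proof -
      have "(int (Suc j) * n, spow S s j) \<in> T"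
        using spow_subsemigroup[OF T n(1), of j] by (simp only: spow_integer_prod)
      then have "(m, s) \<otimes>\<^bsub>integer_group \<times>\<times> S\<^esub> (int (Suc j) * n, spow S s j) \<in> T"
        using T that unfolding subsemigroups_def by blast
      then show ?thesis using j by simp
    qed
    then have "{n. (n, s) \<in> T} \<in> {A. \<forall>x\<in>A. x + int (Suc j) * n \<in> A}"
      by blast
    moreover have "int (Suc j) * n \<in> -{0}"
      using n by simp
    ultimately show ?thesis
      unfolding \<C>_def by blast
  qed
  then have "slices ` subsemigroups (integer_group \<times>\<times> S) \<subseteq> (\<Pi>\<^sub>E s\<in>carrier S. \<C>)"
    by (auto simp: slices_def)
  moreover have "inj_on slices (subsemigroups (integer_group \<times>\<times> S))"
  proof (rule inj_onI)
    fix T U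
    assume T: "T \<in> subsemigroups (integer_group \<times>\<times> S)" "U \<in> subsemigroups (integer_group \<times>\<times> S)"
      and eq: "slices T = slices U"
    have "(n, s) \<in> T \<longleftrightarrow> (n, s) \<in> U" for n s
    proof (cases "s \<in> carrier S")
      case True
      then show ?thesis
        using fun_cong[OF eq, of s] by (auto simp: slices_def)
    qed (use T in \<open>auto simp: subsemigroups_def\<close>)
    then show "T = U" by auto
  qed
  moreover have "countable (\<Pi>\<^sub>E s\<in>carrier S. \<C>)"
    using fin \<open>countable \<C>\<close> by (intro countable_PiE)
  ultimately show ?thesis
    by (meson countable_subset countable_image_inj_on)
qed

subsection \<open>Semigroups that are not completely regular\<close>

lemma additive_int:
  fixes f :: "int \<Rightarrow> int"
  assumes add: "\<And>m n. f (m + n) = f m + f n"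
  shows "f n = f 1 * n"
proof -
  have zero: "f 0 = 0" using add[of 0 0] by simp
  have nat: "f (int k) = f 1 * int k" for k
    by (induction k) (auto simp: zero add algebra_simps)
  show ?thesis
  proof (cases n)
    case (neg k)
    then have "n + int (Suc k) = 0"
      by simp
    with add[of n "int (Suc k)"] have "f n = - f (int (Suc k))"
      using zero by simp
    also have "\<dots> = f 1 * n"
      using neg by (simp only: nat)
    finally show ?thesis .
  qed (use nat in simp)
qed

text \<open>This is \<open>T\<^sub>M\<close>. Any product of two elements lies over a higher power
  of \<open>s\<close>, where all integers are present, so closure puts no constraint on
  \<open>M\<close>.\<close>

definition thick :: "('a, 'm) monoid_scheme \<Rightarrow> 'a \<Rightarrow> int set \<Rightarrow> (int \<times> 'a) set" where
  "thick S s M = M \<times> {s} \<union> UNIV \<times> range (\<lambda>j. spow S s (Suc j))"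

lemma thick_spow:
  assumes "u \<in> thick S s M"
  obtains n j where "u = (n, spow S s j)"
proof -
  obtain n x where "u = (n, x)" "x = spow S s 0 \<or> (\<exists>j. x = spow S s (Suc j))"
    using assms by (auto simp: thick_def)
  then show thesis using that by blast
qed

context carrier_semigroup
begin

lemma thick_subsemigroup:
  assumes s: "s \<in> carrier S"
  shows "thick S s M \<in> subsemigroups (integer_group \<times>\<times> S)"
proof -
  have mem: "(n, spow S s (Suc j)) \<in> thick S s M" for n j
    by (auto simp: thick_def)
  have "u \<otimes>\<^bsub>integer_group \<times>\<times> S\<^esub> v \<in> thick S s M"
    if uv: "u \<in> thick S s M" "v \<in> thick S s M" for u v
  proof -
    obtain i j where "snd u = spow S s i" "snd v = spow S s j"
      using thick_spow uv by (metis snd_conv)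
    then show ?thesis
      using mem[of "fst u + fst v" "i + j"] spow_mult[OF s, of i j]
      by (cases u; cases v) simp
  qed
  moreover have "thick S s M \<subseteq> carrier (integer_group \<times>\<times> S)"
    using s spow_closed[OF s] m_closed by (auto simp: thick_def)
  moreover have "thick S s M \<noteq> {}"
    using mem by blast
  ultimately show ?thesis
    unfolding subsemigroups_def by blast
qed

text \<open>For an idempotent power \<open>e\<close> of \<open>s\<close>, the integers times
  \<open>{e}\<close> form a copy of the integers, on which \<open>\<phi>\<close> is linear. A fixed
  power takes every \<open>u\<close> into this copy, and the factor \<open>Suc k\<close> cancels in
  the integers.\<close>

lemma thick_hom_fst:
  assumes fin: "finite (carrier S)" and s: "s \<in> carrier S"
    and hom: "\<And>u v. u \<in> thick S s M \<Longrightarrow> v \<in> thick S s M \<Longrightarrow>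
      \<phi> (u \<otimes>\<^bsub>integer_group \<times>\<times> S\<^esub> v) = \<phi> u + \<phi> v"
  obtains c :: int where "\<And>u. u \<in> thick S s M \<Longrightarrow> \<phi> u = c * fst u"
proof -
  let ?T = "thick S s M"
  obtain k where k: "spow S s k \<otimes> spow S s k = spow S s k"
    using ex_idempotent_spow fin s by blast
  define e where "e = spow S s k"
  have e_idem: "e \<otimes> e = e" using k by (simp add: e_def)
  \<comment> \<open>Writing \<open>e\<close> as its own square gives it an exponent of at least 2,
    even if \<open>k = 0\<close>.\<close>
  have "e = spow S s (Suc (k + k))"
    using k spow_mult[OF s] by (simp add: e_def)
  then have e_mem: "(n, e) \<in> ?T" for n
    unfolding thick_def by blast
  have linear: "\<phi> (n, e) = \<phi> (1, e) * n" for n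
    using additive_int[of "\<lambda>n. \<phi> (n, e)" n] hom[OF e_mem e_mem] e_idem by simp
  have power: "\<phi> (spow (integer_group \<times>\<times> S) u i) = int (Suc i) * \<phi> u" if "u \<in> ?T" for u i
  proof (induction i)
    case (Suc i)
    then show ?case
      using hom[OF spow_subsemigroup[OF thick_subsemigroup[OF s] that] that, of i]
      by (simp add: algebra_simps)
  qed simp
  have "\<phi> u = \<phi> (1, e) * fst u" if u: "u \<in> ?T" for u
  proof -
    obtain n j where nj: "u = (n, spow S s j)"
      using thick_spow[OF u] by blast
    have "spow S (spow S s j) k = e"
      using spow_spow_commute[OF s, of j k] e_idem by (simp add: e_def spow_idem)
    then have "int (Suc k) * \<phi> u = \<phi> (int (Suc k) * n, e)"
      using power[OF u, of k] by (simp only: nj spow_integer_prod)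
    also have "\<dots> = int (Suc k) * (\<phi> (1, e) * n)"
      by (subst linear) simp
    finally show ?thesis by (simp add: nj)
  qed
  then show thesis by (rule that)
qed

lemma card_thick_fibre:
  assumes fin: "finite (carrier S)" and s: "s \<in> carrier S" and ne: "\<And>j. spow S s (Suc j) \<noteq> s"
  shows "card {u \<in> thick S s M. fst u = n} =
    card (range (\<lambda>j. spow S s (Suc j))) + (if n \<in> M then 1 else 0)"
proof -
  let ?R = "range (\<lambda>j. spow S s (Suc j))"
  have "?R \<subseteq> carrier S"
    using spow_closed[OF s] by blast
  then have finR: "finite ?R"
    using fin finite_subset by blast
  have "s \<notin> ?R" using ne by (metis imageE)
  moreover have "{u \<in> thick S s M. fst u = n} = Pair n ` (if n \<in> M then insert s ?R else ?R)"
    by (auto simp: thick_def)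
  moreover have "card (Pair n ` A) = card A" for A :: "'a set"
    by (simp add: card_image inj_on_def)
  ultimately show ?thesis
    using finR by (simp del: spow.simps)
qed

lemma thick_iso:
  assumes fin: "finite (carrier S)" and s: "s \<in> carrier S" and ne: "\<And>j. spow S s (Suc j) \<noteq> s"
    and iso: "(integer_group \<times>\<times> S)\<lparr>carrier := thick S s M\<rparr> \<cong>
      (integer_group \<times>\<times> S)\<lparr>carrier := thick S s N\<rparr>"
  shows "N = M \<or> N = uminus ` M"
proof -
  let ?P = "integer_group \<times>\<times> S"
  obtain h where bij: "bij_betw h (thick S s M) (thick S s N)"
    and hom: "\<And>u v. u \<in> thick S s M \<Longrightarrow> v \<in> thick S s M \<Longrightarrow>
      h (u \<otimes>\<^bsub>?P\<^esub> v) = h u \<otimes>\<^bsub>?P\<^esub> h v"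
    using iso by (auto simp: is_iso_def iso_def hom_def simp del: mult_DirProd)
  have "fst (h (u \<otimes>\<^bsub>?P\<^esub> v)) = fst (h u) + fst (h v)"
    if "u \<in> thick S s M" "v \<in> thick S s M" for u v
    using hom[OF that] by (cases "h u"; cases "h v") simp
  then obtain c where c: "\<And>u. u \<in> thick S s M \<Longrightarrow> fst (h u) = c * fst u"
    using thick_hom_fst[OF fin s, of M "\<lambda>u. fst (h u)"] by blast
  \<comment> \<open>An element over 1 lies in the image whatever \<open>N\<close> is, so
    \<open>c\<close> divides 1.\<close>
  have "(1, spow S s (Suc 0)) \<in> thick S s N"
    unfolding thick_def by blast
  then obtain u where "u \<in> thick S s M" "h u = (1, spow S s (Suc 0))"
    using bij unfolding bij_betw_def by (metis imageE)
  then have "c * fst u = 1"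
    using c by (metis fst_conv)
  then have c1: "c = 1 \<or> c = -1"
    by (metis zmult_eq_1_iff)
  have fibre: "h ` {u \<in> thick S s M. fst u = n} = {v \<in> thick S s N. fst v = c * n}" for n
  proof (intro equalityI subsetI)
    fix v assume "v \<in> {v \<in> thick S s N. fst v = c * n}"
    then obtain u where "u \<in> thick S s M" "v = h u" "c * fst u = c * n"
      using bij c unfolding bij_betw_def by (metis (mono_tags, lifting) imageE mem_Collect_eq)
    then show "v \<in> h ` {u \<in> thick S s M. fst u = n}"
      using c1 by auto
  next
    fix v assume "v \<in> h ` {u \<in> thick S s M. fst u = n}"
    then show "v \<in> {v \<in> thick S s N. fst v = c * n}"
      using bij_betwE[OF bij] c by blast
  qed
  have "inj_on h {u \<in> thick S s M. fst u = n}" for n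
    by (rule inj_on_subset[OF bij_betw_imp_inj_on[OF bij]]) blast
  then have card_eq: "card {u \<in> thick S s M. fst u = n} = card {v \<in> thick S s N. fst v = c * n}" for n
    unfolding fibre[symmetric] by (simp only: card_image)
  \<comment> \<open>The higher powers of \<open>s\<close> contribute equally to both fibres, so only
    the extra element over \<open>s\<close> is compared.\<close>
  have mem: "n \<in> M \<longleftrightarrow> c * n \<in> N" for n
    using card_eq[of n] unfolding card_thick_fibre[OF fin s ne] by (simp split: if_splits)
  from c1 show ?thesis
  proof
    assume "c = -1"
    then have "n \<in> N \<longleftrightarrow> - n \<in> M" for n
      using mem[of "-n"] by simp
    then have "N = uminus ` M"
      by (force simp: image_iff)
    then show ?thesis ..
  qed (use mem in auto)
qed

section \<open>Uncountably many isomorphism classes\<close>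

lemma uncountable_subsemigroup_classes:
  assumes fin: "finite (carrier S)" and "\<not> completely_regular S"
  shows "\<not> countable (subsemigroups (integer_group \<times>\<times> S) //
    subsemigroup_iso_rel (integer_group \<times>\<times> S))"
proof
  let ?P = "integer_group \<times>\<times> S"
  assume count: "countable (subsemigroups ?P // subsemigroup_iso_rel ?P)"
  obtain s where s: "s \<in> carrier S" and ne: "\<And>j. spow S s (Suc j) \<noteq> s"
    using assms completely_regular_iff by blast
  \<comment> \<open>Using only positive integers removes the sign ambiguity: a set of positive
    integers equals the negative of another only if both are empty.\<close>
  define pos :: "nat set \<Rightarrow> int set" where "pos A = (\<lambda>n. int (Suc n)) ` A" for A
  define cls where "cls A = subsemigroup_iso_rel ?P `` {thick S s (pos A)}" for A
  have "inj cls"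
  proof (rule injI)
    fix A B assume "cls A = cls B"
    then have "(thick S s (pos A), thick S s (pos B)) \<in> subsemigroup_iso_rel ?P"
      using eq_equiv_class[OF _ equiv_subsemigroup_iso_rel] thick_subsemigroup[OF s]
      by (metis cls_def)
    then have "pos B = pos A \<or> pos B = uminus ` pos A"
      using thick_iso[OF fin s ne] by (simp add: subsemigroup_iso_rel_def)
    moreover have "pos B \<noteq> uminus ` pos A" if "pos B \<noteq> pos A"
    proof
      assume eq: "pos B = uminus ` pos A"
      have "pos B \<subseteq> {0<..}" "uminus ` pos A \<subseteq> {..<0}"
        by (auto simp: pos_def)
      with eq have "pos B = {}"
        by fastforce
      with eq that show False by simp
    qed
    moreover have "inj pos"
      unfolding pos_def by (simp add: inj_def inj_image_eq_iff)
    ultimately show "A = B"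
      by (metis injD)
  qed
  moreover have "range cls \<subseteq> subsemigroups ?P // subsemigroup_iso_rel ?P"
    using thick_subsemigroup[OF s] by (auto simp: cls_def intro: quotientI)
  ultimately have "countable (UNIV :: nat set set)"
    using count countable_subset countable_image_inj_on by blast
  then obtain f :: "nat set \<Rightarrow> nat" where "inj f"
    by (auto simp: countable_def)
  then have "surj (inv_into UNIV f)"
    by (rule inj_imp_surj_inv)
  then show False
    using Cantors_theorem[of "UNIV :: nat set"] by auto
qed

end

theorem corollary5p1:
  fixes S :: "('a, 'm) monoid_scheme"
  assumes "carrier_semigroup S" and "finite (carrier S)"
  shows "(completely_regular S \<longleftrightarrow> countable (subsemigroups (integer_group \<times>\<times> S))) \<and>
    (countable (subsemigroups (integer_group \<times>\<times> S)) \<longleftrightarrow>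
      countable (subsemigroups (integer_group \<times>\<times> S) // subsemigroup_iso_rel (integer_group \<times>\<times> S)))"
proof -
  interpret carrier_semigroup S by (fact assms(1))
  have "countable (subsemigroups (integer_group \<times>\<times> S) // subsemigroup_iso_rel (integer_group \<times>\<times> S))"
    if "countable (subsemigroups (integer_group \<times>\<times> S))"
    using that by (simp add: quotient_def)
  then show ?thesis
    using assms(2) countable_subsemigroups_integer_prod uncountable_subsemigroup_classes
    by blast
qed

end
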